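(* Let $T$ be an infinite tree without terminal vertices, rooted at a vertex $o$, let $\psi$ be a complex-valued function on $T$, and let $m$ and $n$ be distinct non-negative integers. Then the multiplication operator $M_\psi:\mathcal{L}^{(m)} \to \mathcal{L}^{(n)}$ is not an isometry.
   Context: A tree $T$ is a locally finite, connected, simply connected graph, identified as a set with its collection of vertices. Two vertices are neighbors if there is an edge connecting them; a vertex is terminal if it has a unique neighbor. The distance $d(v,w)$ is the number of edges in the unique path connecting $v$ to $w$. The tree is rooted at a vertex $o$; put $|v| = d(o,v)$ and $T^* = T\setminus\{o\}$. For $v\in T^*$, $v^-$ denotes the unique neighbor of $v$ lying on the path from $o$ to $v$. A function on $T$ is a complex-valued function on the vertices. The discrete derivative of a function $f$ on $T$ is $f'(v) = f(v)-f(v^-)$ for $v\ne o$ and $f'(o)=0$. For $x \geq 1$ define recursively $\ell_0(x)=x$, $\ell_1(x)=1+\log x$, and $\ell_j(x)=1+\log \ell_{j-1}(x)$ for $j\geq 2$. Define $\Lambda_0(x)=1$ and $\Lambda_k(x)=\prod_{j=0}^{k-1}\ell_j(x)$ for $k\ge 1$. For a non-negative integer $k$, the iterated logarithmic Lipschitz space $\mathcal{L}^{(k)}$ is the set of functions $f$ on $T$ with $\sup_{v\in T^*}|f'(v)|\Lambda_k(|v|)<\infty$; it is a Banach space under the norm $\|f\|_k = |f(o)| + \sup_{v \in T^*} |f'(v)|\Lambda_k(|v|)$. The multiplication operator with symbol $\psi$ is $M_\psi f = \psi f$ (pointwise product). The operator $M_\psi:\mathcal{L}^{(m)}\to\mathcal{L}^{(n)}$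 is an isometry if $M_\psi$ maps $\mathcal{L}^{(m)}$ into $\mathcal{L}^{(n)}$ and $\|\psi f\|_n=\|f\|_m$ for all $f\in\mathcal{L}^{(m)}$. *)

theory Defs
  imports Complex_Main
begin

definition simple_path :: "('a \<Rightarrow> 'a \<Rightarrow> bool) \<Rightarrow> 'a \<Rightarrow> 'a list \<Rightarrow> 'a \<Rightarrow> bool" where
  "simple_path E v xs w \<longleftrightarrow>
     xs \<noteq> [] \<and> hd xs = v \<and> last xs = w \<and> distinct xs \<and> successively E xs"

text \<open>A cycle is listed without repeating its first vertex. The bound on the length
  excludes the traversal of a single edge back and forth.\<close>

definition simple_cycle :: "('a \<Rightarrow> 'a \<Rightarrow> bool) \<Rightarrow> 'a list \<Rightarrow> bool" where
  "simple_cycle E xs \<longleftrightarrow>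
     3 \<le> length xs \<and> distinct xs \<and> successively E xs \<and> E (last xs) (hd xs)"

text \<open>Simple connectedness of a graph means the absence of cycles.\<close>

locale tree_graph =
  fixes V :: "'a set" and E :: "'a \<Rightarrow> 'a \<Rightarrow> bool"
  assumes nonempty: "V \<noteq> {}"
    and edge_in_V: "E v w \<Longrightarrow> v \<in> V \<and> w \<in> V"
    and edge_sym: "E v w \<Longrightarrow> E w v"
    and edge_irrefl: "\<not> E v v"
    and locally_finite: "v \<in> V \<Longrightarrow> finite {w. E v w}"
    and connected: "v \<in> V \<Longrightarrow> w \<in> V \<Longrightarrow> \<exists>xs. simple_path E v xs w"
    and simply_connected: "\<not> simple_cycle E xs"

definition terminal_vertex :: "('a \<Rightarrow> 'a \<Rightarrow> bool) \<Rightarrow> 'a \<Rightarrow> bool" where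
  "terminal_vertex E v \<longleftrightarrow> (\<exists>!w. E v w)"

definition tree_path :: "('a \<Rightarrow> 'a \<Rightarrow> bool) \<Rightarrow> 'a \<Rightarrow> 'a \<Rightarrow> 'a list" where
  "tree_path E v w = (THE xs. simple_path E v xs w)"

definition tree_dist :: "('a \<Rightarrow> 'a \<Rightarrow> bool) \<Rightarrow> 'a \<Rightarrow> 'a \<Rightarrow> nat" where
  "tree_dist E v w = length (tree_path E v w) - 1"

definition tree_parent :: "('a \<Rightarrow> 'a \<Rightarrow> bool) \<Rightarrow> 'a \<Rightarrow> 'a \<Rightarrow> 'a" where
  "tree_parent E r v = (THE u. E v u \<and> u \<in> set (tree_path E r v))"

definition tree_deriv :: "('a \<Rightarrow> 'a \<Rightarrow> bool) \<Rightarrow> 'a \<Rightarrow> ('a \<Rightarrow> complex) \<Rightarrow> 'a \<Rightarrow> complex" where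
  "tree_deriv E r f v = (if v = r then 0 else f v - f (tree_parent E r v))"

primrec iter_log :: "nat \<Rightarrow> real \<Rightarrow> real" where
  "iter_log 0 x = x"
| "iter_log (Suc j) x = 1 + ln (iter_log j x)"

definition Lambda_weight :: "nat \<Rightarrow> real \<Rightarrow> real" where
  "Lambda_weight k x = (\<Prod>j<k. iter_log j x)"

text \<open>A function on the tree is represented by a function on the whole type \<^typ>\<open>'a\<close>;
  its values outside \<open>V\<close> play no role in any of the following notions.\<close>

definition log_Lipschitz ::
    "'a set \<Rightarrow> ('a \<Rightarrow> 'a \<Rightarrow> bool) \<Rightarrow> 'a \<Rightarrow> nat \<Rightarrow> ('a \<Rightarrow> complex) set" where
  "log_Lipschitz V E r k =
     {f. bdd_above ((\<lambda>v. cmod (tree_deriv E r f v) * Lambda_weight k (real (tree_dist E r v)))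
                     ` (V - {r}))}"

definition log_Lipschitz_norm ::
    "'a set \<Rightarrow> ('a \<Rightarrow> 'a \<Rightarrow> bool) \<Rightarrow> 'a \<Rightarrow> nat \<Rightarrow> ('a \<Rightarrow> complex) \<Rightarrow> real" where
  "log_Lipschitz_norm V E r k f =
     cmod (f r) +
     (SUP v\<in>V - {r}. cmod (tree_deriv E r f v) * Lambda_weight k (real (tree_dist E r v)))"

definition mult_op :: "('a \<Rightarrow> complex) \<Rightarrow> ('a \<Rightarrow> complex) \<Rightarrow> 'a \<Rightarrow> complex" where
  "mult_op \<psi> f = (\<lambda>v. \<psi> v * f v)"

definition mult_op_isometry ::
    "'a set \<Rightarrow> ('a \<Rightarrow> 'a \<Rightarrow> bool) \<Rightarrow> 'a \<Rightarrow> ('a \<Rightarrow> complex) \<Rightarrow> nat \<Rightarrow> nat \<Rightarrow> bool" where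
  "mult_op_isometry V E r \<psi> m n \<longleftrightarrow>
     mult_op \<psi> ` log_Lipschitz V E r m \<subseteq> log_Lipschitz V E r n \<and>
     (\<forall>f \<in> log_Lipschitz V E r m.
        log_Lipschitz_norm V E r n (mult_op \<psi> f) = log_Lipschitz_norm V E r m f)"

end

(* The characteristic function of a vertex v \<noteq> r has k-norm \<Lambda>_k(|v| + 1), the supremum being attained
   at the children of v, and that of r has k-norm 2. If multiplication by \<psi> were an isometry, then
   |\<psi>(v)| \<Lambda>_n(|v| + 1) = \<Lambda>_m(|v| + 1) for v \<noteq> r, and |\<psi>(r)| = 1. As the constant 1 has norm 1, so
   has \<psi>, which leaves no room for its derivative: \<psi> is constant of modulus 1. At |v| = 1
   this gives \<Lambda>_m(2) = \<Lambda>_n(2), but \<Lambda>_k(2) is strictly increasing in k. *)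
theory Submission
  imports Defs
begin

section \<open>Iterated logarithms and the weights\<close>

lemma iter_log_ge_1: "1 \<le> x \<Longrightarrow> 1 \<le> iter_log j x"
  by (induction j) auto

lemma iter_log_gt_1: "1 < x \<Longrightarrow> 1 < iter_log j x"
  by (induction j) auto

lemma iter_log_1: "iter_log j 1 = 1"
  by (induction j) auto

lemma iter_log_mono:
  assumes "1 \<le> x" "x \<le> y"
  shows "iter_log j x \<le> iter_log j y"
proof (induction j)
  case (Suc j)
  with iter_log_ge_1[OF assms(1), of j] show ?case
    by simp
qed (use assms in simp)

lemma Lambda_weight_1: "Lambda_weight k 1 = 1"
  by (simp add: Lambda_weight_def iter_log_1)

lemma Lambda_weight_pos: "1 \<le> x \<Longrightarrow> 0 < Lambda_weight k x"
  unfolding Lambda_weight_def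
  by (intro prod_pos) (use iter_log_ge_1 less_le_trans zero_less_one in blast)

lemma Lambda_weight_mono:
  assumes "1 \<le> x" "x \<le> y"
  shows "Lambda_weight k x \<le> Lambda_weight k y"
  unfolding Lambda_weight_def
proof (intro prod_mono conjI)
  fix j
  show "0 \<le> iter_log j x"
    using iter_log_ge_1[OF assms(1), of j] by simp
qed (simp add: assms iter_log_mono)

text \<open>Passing from \<open>k\<close> to \<open>Suc k\<close> multiplies the weight by
  \<open>iter_log k x\<close>, which exceeds 1. At \<open>x = 1\<close> every weight equals 1, so
  only arguments above 1 can tell \<open>m\<close> from \<open>n\<close>.\<close>

lemma strict_mono_Lambda_weight:
  assumes "1 < x"
  shows "strict_mono (\<lambda>k. Lambda_weight k x)"
  unfolding strict_mono_Suc_iff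
proof
  fix k
  have "Lambda_weight k x * 1 < Lambda_weight k x * iter_log k x"
    using iter_log_gt_1[OF assms] Lambda_weight_pos assms
    by (intro mult_strict_left_mono) auto
  then show "Lambda_weight k x < Lambda_weight (Suc k) x"
    by (simp add: Lambda_weight_def)
qed

section \<open>Paths, distances and parents in a rooted tree\<close>

context tree_graph
begin

lemma simple_path_unique:
  assumes "simple_path E v xs w" "simple_path E v ys w"
  shows "xs = ys"
  using assms
proof (induction xs arbitrary: v ys)
  case Nil
  then show ?case by (simp add: simple_path_def)
next
  case (Cons a xs)
  then obtain ys' where ys: "ys = v # ys'" and a: "a = v"
    by (cases ys) (auto simp: simple_path_def)
  show ?case
  proof (cases "xs = [] \<or> ys' = []")
    case True
    \<comment> \<open>An empty tail forces \<open>w = v\<close>; the other list is distinct and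
      begins and ends with \<open>v\<close>, so its tail is empty too.\<close>
    then show ?thesis
      using Cons.prems unfolding ys a simple_path_def
      by (auto split: if_splits)
  next
    case False
    have lasts: "last xs = w" "last ys' = w"
      using Cons.prems False unfolding ys a simple_path_def by auto
    then have "\<exists>z\<in>set xs. z \<in> set ys'"
      using False by (metis last_in_set)
    then obtain as z bs where xs: "xs = as @ z # bs" "z \<in> set ys'" "\<forall>x\<in>set as. x \<notin> set ys'"
      using split_list_first_prop[of xs "\<lambda>z. z \<in> set ys'"] by blast
    \<comment> \<open>Both paths leave \<open>v\<close>, and \<open>z\<close> is where the first one meets the second one again: going to
      \<open>z\<close> along one and back along the other closes a cycle, unless \<open>z\<close> is a neighbour on both.\<close>
    obtain cs ds where ys': "ys' = cs @ z # ds"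
      using xs(2) by (meson split_list)
    have "\<not> simple_cycle E (v # as @ z # rev cs)"
      by (rule simply_connected)
    moreover have "distinct (v # as @ z # rev cs)"
      using Cons.prems xs(3) unfolding ys a xs(1) ys' simple_path_def by auto
    moreover have "successively E (v # as @ z # rev cs)"
    proof -
      have "successively E (v # cs @ [z])"
        using Cons.prems unfolding ys ys' simple_path_def
        by (auto simp: successively_append_iff successively_Cons hd_append)
      then have "successively E (rev (v # cs @ [z]))"
        unfolding successively_rev
        by (rule successively_mono) (use edge_sym in auto)
      then have "successively E (z # rev cs)"
        by (auto simp: successively_append_iff successively_Cons hd_append split: if_splits)
      moreover have "successively E (v # as @ [z])"
        using Cons.prems unfolding a xs(1) simple_path_def
        by (auto simp: successively_append_iff successively_Cons hd_append)
      ultimately show ?thesis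
        by (auto simp: successively_append_iff successively_Cons hd_append)
    qed
    moreover have "E (last (v # as @ z # rev cs)) (hd (v # as @ z # rev cs))"
    proof -
      have "E v (hd ys')"
        using Cons.prems False unfolding ys simple_path_def by (auto simp: successively_Cons)
      then show ?thesis
        by (cases cs) (auto simp: ys' edge_sym)
    qed
    \<comment> \<open>Only the length condition for a cycle can fail, so
      \<open>2 + length as + length cs < 3\<close>.\<close>
    ultimately have "as = [] \<and> cs = []"
      unfolding simple_cycle_def by (auto simp: not_le less_Suc_eq)
    then have hds: "hd xs = z" "hd ys' = z"
      by (simp_all add: xs(1) ys')
    have "simple_path E z xs w" "simple_path E z ys' w"
      using Cons.prems False hds lasts unfolding ys a simple_path_def
      by (auto simp: successively_Cons)
    then have "xs = ys'"
      by (rule Cons.IH)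
    then show ?thesis
      by (simp add: ys a)
  qed
qed

lemma tree_path_eq: "simple_path E v xs w \<Longrightarrow> tree_path E v w = xs"
  unfolding tree_path_def by (blast intro: simple_path_unique)

lemma simple_path_tree_path: "v \<in> V \<Longrightarrow> w \<in> V \<Longrightarrow> simple_path E v (tree_path E v w) w"
  using connected tree_path_eq by metis

lemma tree_dist_self: "tree_dist E v v = 0"
proof -
  have "simple_path E v [v] v"
    by (simp add: simple_path_def)
  then show ?thesis
    by (simp add: tree_dist_def tree_path_eq)
qed

lemma simple_path_butlast:
  assumes "simple_path E v (xs @ [w]) u" "xs \<noteq> []"
  shows "simple_path E v xs (last xs)" "E (last xs) w"
  using assms by (auto simp: simple_path_def successively_append_iff)

text \<open>If a neighbour \<open>u\<close> of \<open>v\<close> lies on the path from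
  \<open>r\<close> to \<open>v\<close>, cutting the path at \<open>u\<close> and stepping directly
  to \<open>v\<close> gives a simple path again. By uniqueness nothing was cut out, so
  \<open>u\<close> is the last vertex before \<open>v\<close>.\<close>

lemma tree_parent_eq:
  assumes path: "simple_path E r (xs @ [v]) v" and ne: "xs \<noteq> []"
  shows "tree_parent E r v = last xs"
  unfolding tree_parent_def tree_path_eq[OF path]
proof (rule the_equality)
  show "E v (last xs) \<and> last xs \<in> set (xs @ [v])"
    using simple_path_butlast[OF assms] ne by (auto intro: edge_sym)
next
  fix u
  assume u: "E v u \<and> u \<in> set (xs @ [v])"
  then have "u \<in> set xs"
    using edge_irrefl by auto
  then obtain as bs where xs: "xs = as @ u # bs"
    by (meson split_list)
  have "simple_path E r ((as @ [u]) @ [v]) v"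
    using path u unfolding xs simple_path_def
    by (auto simp: successively_append_iff hd_append edge_sym split: if_splits)
  then have "(as @ [u]) @ [v] = xs @ [v]"
    using path by (rule simple_path_unique)
  then show "u = last xs"
    by auto
qed

lemma tree_path_snoc:
  assumes "r \<in> V" "v \<in> V" "v \<noteq> r"
  obtains xs where "xs \<noteq> []" "tree_path E r v = xs @ [v]" "simple_path E r (xs @ [v]) v"
proof -
  have path: "simple_path E r (tree_path E r v) v"
    using assms by (simp add: simple_path_tree_path)
  then obtain xs where xs: "tree_path E r v = xs @ [v]"
    unfolding simple_path_def by (metis append_butlast_last_id)
  moreover have "xs \<noteq> []"
    using path assms(3) unfolding xs by (auto simp: simple_path_def)
  ultimately show thesis
    using path that by simp
qed

text \<open>The path to the parent is the path to \<open>v\<close> without its last vertex; it is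
  nonempty, so the truncated subtraction in \<open>tree_dist\<close> is exact.\<close>

lemma tree_dist_parent:
  assumes "r \<in> V" "v \<in> V" "v \<noteq> r"
  shows "tree_dist E r v = Suc (tree_dist E r (tree_parent E r v))"
proof -
  obtain xs where xs: "xs \<noteq> []" "tree_path E r v = xs @ [v]" "simple_path E r (xs @ [v]) v"
    using assms by (rule tree_path_snoc)
  have "tree_path E r (tree_parent E r v) = xs"
    using simple_path_butlast(1)[OF xs(3,1)]
    by (simp add: tree_parent_eq[OF xs(3,1)] tree_path_eq)
  then show ?thesis
    using xs by (simp add: tree_dist_def)
qed

text \<open>The path to \<open>v\<close> extends by \<open>w\<close> unless it already contains
  \<open>w\<close>; in that case the shortcut from \<open>w\<close> to \<open>v\<close> would make
  \<open>w\<close> the parent of \<open>v\<close>.\<close>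

lemma tree_parent_edge:
  assumes "r \<in> V" "E v w" "v = r \<or> w \<noteq> tree_parent E r v"
  shows "tree_parent E r w = v" "w \<noteq> r"
proof -
  have v: "v \<in> V"
    using assms(2) edge_in_V by blast
  have path: "simple_path E r (tree_path E r v) v"
    using assms(1) v by (rule simple_path_tree_path)
  have w: "w \<notin> set (tree_path E r v)"
  proof
    assume w: "w \<in> set (tree_path E r v)"
    show False
    proof (cases "v = r")
      case True
      then have "tree_path E r v = [r]"
        by (intro tree_path_eq) (simp add: simple_path_def)
      with w True assms(2) edge_irrefl show False
        by simp
    next
      case False
      then obtain xs where xs: "xs \<noteq> []" "tree_path E r v = xs @ [v]"
          "simple_path E r (xs @ [v]) v"
        using assms(1) v by (metis tree_path_snoc)
      have "w \<in> set xs"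
        using w xs(2) assms(2) edge_irrefl by auto
      then obtain as bs where as: "xs = as @ w # bs"
        by (meson split_list)
      have "simple_path E r ((as @ [w]) @ [v]) v"
        using xs(3) assms(2) unfolding as simple_path_def
        by (auto simp: successively_append_iff hd_append edge_sym split: if_splits)
      then have "tree_parent E r v = w"
        using tree_parent_eq by fastforce
      with assms(3) False show False
        by simp
    qed
  qed
  have "simple_path E r (tree_path E r v @ [w]) w"
    using path w assms(2) by (auto simp: simple_path_def successively_append_iff)
  then show "tree_parent E r w = v"
    using path tree_parent_eq[of r "tree_path E r v" w] by (simp add: simple_path_def)
  have "r \<in> set (tree_path E r v)"
    using path unfolding simple_path_def by (metis hd_in_set)
  with w show "w \<noteq> r"
    by blast
qed

section \<open>Norms of the test functions\<close>

text \<open>The derivative has modulus \<open>cmod c\<close> at the children of \<open>v\<close>,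
  and at \<open>v\<close> itself if \<open>v \<noteq> r\<close>, where the weight is no larger; it
  vanishes elsewhere. The child \<open>w\<close> ensures that the bound is attained.\<close>

lemma log_Lipschitz_norm_indicator:
  fixes c :: complex
  assumes "r \<in> V" "v \<in> V" "w \<in> V" "w \<noteq> r" "tree_parent E r w = v"
  defines "f \<equiv> \<lambda>u. if u = v then c else 0"
  shows "f \<in> log_Lipschitz V E r k"
    and "log_Lipschitz_norm V E r k f =
      cmod (f r) + cmod c * Lambda_weight k (real (tree_dist E r v) + 1)"
proof -
  let ?g = "\<lambda>u. cmod (tree_deriv E r f u) * Lambda_weight k (real (tree_dist E r u))"
  let ?B = "cmod c * Lambda_weight k (real (tree_dist E r v) + 1)"
  have le: "?g u \<le> ?B" if u: "u \<in> V - {r}" for u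
  proof -
    have dist: "tree_dist E r u = Suc (tree_dist E r (tree_parent E r u))"
      using assms(1) u by (intro tree_dist_parent) auto
    consider "u = v" | "u \<noteq> v" "tree_parent E r u = v" | "u \<noteq> v" "tree_parent E r u \<noteq> v"
      by blast
    then show ?thesis
    proof cases
      case 1
      then have "tree_parent E r u \<noteq> v"
        using dist by auto
      then show ?thesis
        using 1 u dist
        by (auto simp: tree_deriv_def f_def intro!: mult_left_mono Lambda_weight_mono)
    next
      case 2
      then show ?thesis
        using u dist by (simp add: tree_deriv_def f_def add.commute)
    next
      case 3
      then show ?thesis
        using u Lambda_weight_pos[of "real (tree_dist E r v) + 1" k]
        by (simp add: tree_deriv_def f_def)
    qed
  qed
  have dist_w: "tree_dist E r w = Suc (tree_dist E r v)"
    using tree_dist_parent[of r w] assms by simp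
  then have "w \<noteq> v"
    by auto
  then have "?g w = ?B"
    using assms(4,5) dist_w by (simp add: tree_deriv_def f_def add.commute)
  moreover have "w \<in> V - {r}"
    using assms by simp
  ultimately have "?B \<in> ?g ` (V - {r})"
    by (metis (no_types, lifting) image_eqI)
  then have "(SUP u\<in>V - {r}. ?g u) = ?B"
    using le by (intro cSup_eq_maximum) auto
  then show "log_Lipschitz_norm V E r k f = cmod (f r) + ?B"
    by (simp add: log_Lipschitz_norm_def)
  show "f \<in> log_Lipschitz V E r k"
    using le unfolding log_Lipschitz_def by (auto intro!: bdd_aboveI2)
qed

text \<open>If \<open>V - {r}\<close> were empty, the supremum in the norm would be taken over the
  empty set, where its value is unspecified.\<close>

lemma log_Lipschitz_norm_one:
  assumes "V - {r} \<noteq> {}"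
  shows "(\<lambda>_. 1) \<in> log_Lipschitz V E r k" "log_Lipschitz_norm V E r k (\<lambda>_. 1) = 1"
proof -
  have "tree_deriv E r (\<lambda>_. 1) v = 0" for v
    by (simp add: tree_deriv_def)
  then show "(\<lambda>_. 1) \<in> log_Lipschitz V E r k" "log_Lipschitz_norm V E r k (\<lambda>_. 1) = 1"
    using assms by (auto simp: log_Lipschitz_def log_Lipschitz_norm_def intro: bdd_aboveI2)
qed

text \<open>The supremum in the norm must be 0, and away from the root the weights are
  positive.\<close>

lemma deriv_eq_0_of_norm_eq:
  assumes "f \<in> log_Lipschitz V E r k" "log_Lipschitz_norm V E r k f = cmod (f r)"
    and "r \<in> V" "v \<in> V" "v \<noteq> r"
  shows "tree_deriv E r f v = 0"
proof -
  have "cmod (tree_deriv E r f v) * Lambda_weight k (real (tree_dist E r v)) \<le> 0"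
    using assms cSUP_upper[of v "V - {r}"
        "\<lambda>v. cmod (tree_deriv E r f v) * Lambda_weight k (real (tree_dist E r v))"]
    unfolding log_Lipschitz_def log_Lipschitz_norm_def by auto
  moreover have "0 < Lambda_weight k (real (tree_dist E r v))"
    using tree_dist_parent[OF assms(3-5)] by (intro Lambda_weight_pos) simp
  ultimately show ?thesis
    by (simp add: mult_le_0_iff)
qed

end

theorem theorem5p1:
  fixes V :: "'a set" and E :: "'a \<Rightarrow> 'a \<Rightarrow> bool" and r :: 'a
    and \<psi> :: "'a \<Rightarrow> complex" and m n :: nat
  assumes "tree_graph V E" and "infinite V" and "r \<in> V"
    and "\<And>v. v \<in> V \<Longrightarrow> \<not> terminal_vertex E v"
    and "m \<noteq> n"
  shows "\<not> mult_op_isometry V E r \<psi> m n"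
proof
  interpret tree_graph V E
    by fact
  assume iso: "mult_op_isometry V E r \<psi> m n"
  have norm_eq: "log_Lipschitz_norm V E r n (mult_op \<psi> f) = log_Lipschitz_norm V E r m f"
    if "f \<in> log_Lipschitz V E r m" for f
    using iso that by (simp add: mult_op_isometry_def)
  \<comment> \<open>The \<open>if\<close> term is the value at the root in the norm; it lets one
    equation cover both \<open>v = r\<close> and \<open>v \<noteq> r\<close>.\<close>
  have indicator: "cmod (\<psi> v) * (cmod (if r = v then 1 else 0) + Lambda_weight n (real (tree_dist E r v) + 1)) =
      cmod (if r = v then 1 else 0) + Lambda_weight m (real (tree_dist E r v) + 1)"
    if w: "v \<in> V" "w \<in> V" "w \<noteq> r" "tree_parent E r w = v" for v w
  proof -
    have "mult_op \<psi> (\<lambda>u. if u = v then 1 else 0) = (\<lambda>u. if u = v then \<psi> v else 0)"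
      by (auto simp: mult_op_def)
    then show ?thesis
      using norm_eq[OF log_Lipschitz_norm_indicator(1)[OF \<open>r \<in> V\<close> w, where c = 1 and k = m]]
        log_Lipschitz_norm_indicator(2)[OF \<open>r \<in> V\<close> w, where c = 1 and k = m]
        log_Lipschitz_norm_indicator(2)[OF \<open>r \<in> V\<close> w, where c = "\<psi> v" and k = n]
      by (auto simp: algebra_simps)
  qed

  have nontrivial: "V - {r} \<noteq> {}"
    using \<open>infinite V\<close> by (metis finite.emptyI infinite_remove)
  then obtain u where u: "u \<in> V" "u \<noteq> r"
    by blast
  obtain xs where path: "simple_path E r xs u"
    using connected \<open>r \<in> V\<close> u(1) by blast
  \<comment> \<open>\<open>v\<close> is the second vertex of the path to \<open>u\<close>; the rule
    \<open>remdups_adj.cases\<close> serves to split off lists of length 0 and 1.\<close>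
  then obtain v where v: "E r v"
    using u(2) unfolding simple_path_def
    by (cases xs rule: remdups_adj.cases) (auto simp: successively_Cons)
  have "v \<in> V"
    using edge_in_V v by blast
  have parent_v: "tree_parent E r v = r" and "v \<noteq> r"
    using tree_parent_edge[OF \<open>r \<in> V\<close> v] by auto
  have "\<not> terminal_vertex E v"
    using assms(4) \<open>v \<in> V\<close> .
  \<comment> \<open>\<open>r\<close> is a neighbour of \<open>v\<close>, so a non-terminal
    \<open>v\<close> has a second one, which is then a child of \<open>v\<close>.\<close>
  then obtain w where w: "E v w" "w \<noteq> r"
    using edge_sym[OF v] unfolding terminal_vertex_def by blast
  then have parent_w: "tree_parent E r w = v" and "w \<in> V"
    using tree_parent_edge[OF \<open>r \<in> V\<close> w(1)] parent_v edge_in_V by auto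
  have dist_v: "tree_dist E r v = 1"
    using tree_dist_parent[OF \<open>r \<in> V\<close> \<open>v \<in> V\<close> \<open>v \<noteq> r\<close>] by (simp add: parent_v tree_dist_self)

  \<comment> \<open>At the root both weights are taken at 1, so the equation reads
    \<open>cmod (\<psi> r) * 2 = 2\<close>.\<close>
  have psi_r: "cmod (\<psi> r) = 1"
    using indicator[OF \<open>r \<in> V\<close> \<open>v \<in> V\<close> \<open>v \<noteq> r\<close> parent_v]
    by (simp add: tree_dist_self Lambda_weight_1)
  have one: "mult_op \<psi> (\<lambda>_. 1) = \<psi>"
    by (simp add: mult_op_def)
  have "tree_deriv E r \<psi> v = 0"
  proof (rule deriv_eq_0_of_norm_eq)
    show "\<psi> \<in> log_Lipschitz V E r n"
      using iso log_Lipschitz_norm_one(1)[OF nontrivial] one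
      unfolding mult_op_isometry_def by (metis image_subset_iff)
    show "log_Lipschitz_norm V E r n \<psi> = cmod (\<psi> r)"
      using norm_eq[OF log_Lipschitz_norm_one(1)[OF nontrivial]]
        log_Lipschitz_norm_one(2)[OF nontrivial] one psi_r by simp
  qed fact+
  then have "cmod (\<psi> v) = 1"
    using \<open>v \<noteq> r\<close> psi_r by (simp add: tree_deriv_def parent_v)
  then have "Lambda_weight n 2 = Lambda_weight m 2"
    using indicator[OF \<open>v \<in> V\<close> \<open>w \<in> V\<close> w(2) parent_w] \<open>v \<noteq> r\<close> by (simp add: dist_v)
  then show False
    using strict_mono_eq[OF strict_mono_Lambda_weight[of 2]] \<open>m \<noteq> n\<close> by auto
qed

end
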